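(* Let $X$ be a uniformly convex complex Banach space and $Y$ an arbitrary complex Banach space. Then every element of $\mathcal{A}_u(B_X;Y)$ can be approximated in the norm $\|\cdot\|_\infty$ by elements of $\mathcal{A}_u(B_X;Y)$ which attain their $v$-norm; that is, $$\overline{\operatorname{NA}_v\mathcal{A}_u(B_X;Y)}^{\|\cdot\|_\infty}=\mathcal{A}_u(B_X;Y).$$
   Context: All Banach spaces are complex; $B_X$ is the open unit ball of $X$ and $\overline{B_X}$ the closed unit ball. $\mathcal{A}_u(B_X;Y)$ is the space of holomorphic functions $f:B_X\to Y$ which are uniformly continuous on $B_X$ (hence bounded, and extending continuously to $\overline{B_X}$). $\|f\|_\infty=\sup_{x\in B_X}\|f(x)\|$ and $\|f\|_v=\sup_{x\in B_X}(1-\|x\|^2)\|f(x)\|$. The function $f$ attains its $v$-norm if there is $x_0\in\overline{B_X}$ with $\|f\|_v=(1-\|x_0\|^2)\|f(x_0)\|$. $\operatorname{NA}_v\mathcal{A}_u(B_X;Y)$ is the set of all $f\in\mathcal{A}_u(B_X;Y)$ attaining their $v$-norm. *)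

theory Defs
  imports "HOL-Analysis.Analysis"
begin

class complex_normed_vector = real_normed_vector +
  fixes scaleC :: "complex \<Rightarrow> 'a \<Rightarrow> 'a"  (infixr "*\<^sub>C" 75)
  assumes scaleC_add_right: "c *\<^sub>C (x + y) = c *\<^sub>C x + c *\<^sub>C y"
    and scaleC_add_left: "(c + d) *\<^sub>C x = c *\<^sub>C x + d *\<^sub>C x"
    and scaleC_scaleC: "c *\<^sub>C d *\<^sub>C x = (c * d) *\<^sub>C x"
    and scaleC_one: "1 *\<^sub>C x = x"
    and scaleR_scaleC: "r *\<^sub>R x = complex_of_real r *\<^sub>C x"
    and norm_scaleC: "norm (c *\<^sub>C x) = cmod c * norm x"

class complex_banach = complex_normed_vector + complete_space

subclass (in complex_banach) banach ..

instantiation complex :: complex_banach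
begin

definition scaleC_complex :: "complex \<Rightarrow> complex \<Rightarrow> complex"
  where "scaleC_complex c x = c * x"

instance
  by standard (auto simp: scaleC_complex_def algebra_simps norm_mult scaleR_conv_of_real)

end

definition uniformly_convex :: "'a::real_normed_vector itself \<Rightarrow> bool" where
  "uniformly_convex _ \<longleftrightarrow>
    (\<forall>\<epsilon>>0. \<exists>\<delta>>0. \<forall>x y :: 'a. norm x = 1 \<longrightarrow> norm y = 1 \<longrightarrow> norm (x - y) \<ge> \<epsilon> \<longrightarrow>
      norm ((1/2) *\<^sub>R (x + y)) \<le> 1 - \<delta>)"

text \<open>Holomorphy between complex Banach spaces: Frechet differentiability with a (bounded)
  complex-linear derivative at every point.  For an open set it does not depend on the values
  of the function outside the set.\<close>

definition cholomorphic_on ::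
  "('a::complex_normed_vector \<Rightarrow> 'b::complex_normed_vector) \<Rightarrow> 'a set \<Rightarrow> bool" where
  "cholomorphic_on f S \<longleftrightarrow>
    (\<forall>x\<in>S. \<exists>D. (f has_derivative D) (at x) \<and> (\<forall>c h. D (c *\<^sub>C h) = c *\<^sub>C D h))"

text \<open>A function on the open unit ball is represented by a total function that takes the
  conventional value \<open>undefined\<close> outside the ball, so that equality of elements of \<open>A_u\<close> is
  equality on the ball.\<close>

definition A_u :: "('a::complex_banach \<Rightarrow> 'b::complex_banach) set" where
  "A_u = {f \<in> extensional (ball 0 1). cholomorphic_on f (ball 0 1) \<and>
                                      uniformly_continuous_on (ball 0 1) f}"

text \<open>The suprema below are taken in the reals; the sets are bounded for members of \<open>A_u\<close>
  (lemma \<open>A_u_bounded\<close>).\<close>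

definition sup_norm :: "('a::real_normed_vector \<Rightarrow> 'b::real_normed_vector) \<Rightarrow> real" where
  "sup_norm f = (SUP x\<in>ball 0 1. norm (f x))"

definition v_norm :: "('a::real_normed_vector \<Rightarrow> 'b::real_normed_vector) \<Rightarrow> real" where
  "v_norm f = (SUP x\<in>ball 0 1. (1 - (norm x)\<^sup>2) * norm (f x))"

text \<open>The metric of the norm \<open>sup_norm\<close> on \<open>A_u\<close>.  Outside \<open>A_u\<close>, where the supremum may be
  unspecified, it is set to 0 because the locale \<open>Metric_space\<close> requires nonnegativity on the
  whole type.\<close>

definition sup_dist ::
  "('a::complex_banach \<Rightarrow> 'b::complex_banach) \<Rightarrow> ('a \<Rightarrow> 'b) \<Rightarrow> real" where
  "sup_dist f g = (if f \<in> A_u \<and> g \<in> A_u then sup_norm (\<lambda>x. f x - g x) else 0)"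

text \<open>The continuous extension to the closed ball; only its values on the closed ball matter.\<close>

definition cball_ext :: "('a::real_normed_vector \<Rightarrow> 'b::real_normed_vector) \<Rightarrow> 'a \<Rightarrow> 'b" where
  "cball_ext f x = (if x \<in> ball 0 1 then f x else Lim (at x within ball 0 1) f)"

definition attains_v_norm :: "('a::real_normed_vector \<Rightarrow> 'b::real_normed_vector) \<Rightarrow> bool" where
  "attains_v_norm f \<longleftrightarrow>
    (\<exists>x\<^sub>0\<in>cball 0 1. v_norm f = (1 - (norm x\<^sub>0)\<^sup>2) * norm (cball_ext f x\<^sub>0))"

definition NA_v :: "('a::complex_banach \<Rightarrow> 'b::complex_banach) set" where
  "NA_v = {f \<in> A_u. attains_v_norm f}"

lemma A_u_bounded:
  assumes "f \<in> A_u"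
  shows "bounded (f ` ball 0 1)"
proof -
  from assms have "uniformly_continuous_on (ball 0 1) f" by (simp add: A_u_def)
  then obtain d where d: "d > 0"
    "\<And>x y. x \<in> ball 0 1 \<Longrightarrow> y \<in> ball 0 1 \<Longrightarrow> dist y x < d \<Longrightarrow> dist (f y) (f x) < 1"
    unfolding uniformly_continuous_on_def by (meson zero_less_one)
  obtain n :: nat where n: "n > 0" "1 / real n < d"
    by (metis d(1) inverse_eq_divide reals_Archimedean neq0_conv of_nat_0 of_nat_Suc zero_less_Suc)
  have "norm (f x) \<le> norm (f 0) + real n" if x: "x \<in> ball 0 1" for x
  proof -
    let ?p = "\<lambda>k::nat. (real k / real n) *\<^sub>R x"
    have p: "?p k \<in> ball 0 1" if "k \<le> n" for k
    proof -
      have "real k / real n * norm x \<le> 1 * norm x"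
        using that n by (intro mult_right_mono) auto
      with x show ?thesis by simp
    qed
    have "norm (f (?p k)) \<le> norm (f 0) + real k" if "k \<le> n" for k
      using that
    proof (induction k)
      case (Suc k)
      have "?p (Suc k) - ?p k = (1 / real n) *\<^sub>R x"
        by (simp add: scaleR_left_diff_distrib [symmetric] diff_divide_distrib [symmetric])
      then have "dist (?p (Suc k)) (?p k) = 1 / real n * norm x"
        by (simp add: dist_norm)
      also have "\<dots> \<le> 1 / real n * 1" using x by (intro mult_left_mono) auto
      finally have "dist (?p (Suc k)) (?p k) < d" using n by simp
      then have "dist (f (?p (Suc k))) (f (?p k)) < 1"
        using d(2) [OF p [of k] p [of "Suc k"]] Suc.prems by linarith
      then show ?case
        using Suc norm_triangle_sub [of "f (?p (Suc k))" "f (?p k)"] by (simp add: dist_norm)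
    qed simp
    from this [of n] n show ?thesis by simp
  qed
  then show ?thesis unfolding bounded_iff by blast
qed

lemma Metric_space_A_u:
  "Metric_space (A_u :: ('a::complex_banach \<Rightarrow> 'b::complex_banach) set) sup_dist"
proof
  have bdd: "bdd_above ((\<lambda>x. norm (f x - g x)) ` ball 0 1)"
    if "f \<in> A_u" "g \<in> A_u" for f g :: "'a \<Rightarrow> 'b"
    using bounded_minus_comp [OF that [THEN A_u_bounded]] 
    by (simp add: bounded_imp_bdd_above bounded_norm_comp)
  have le: "norm (f x - g x) \<le> sup_dist f g"
    if "f \<in> A_u" "g \<in> A_u" "x \<in> ball 0 1" for f g :: "'a \<Rightarrow> 'b" and x
    using cSUP_upper [OF that(3) bdd [OF that(1,2)]] that by (simp add: sup_dist_def sup_norm_def)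
  show "sup_dist f g = sup_dist g f" for f g :: "'a \<Rightarrow> 'b"
    by (simp add: sup_dist_def sup_norm_def norm_minus_commute)
  show "0 \<le> sup_dist f g" for f g :: "'a \<Rightarrow> 'b"
  proof (cases "f \<in> A_u \<and> g \<in> A_u")
    case True
    then show ?thesis
      using order_trans [OF norm_ge_zero le [of f g 0]] by simp
  qed (auto simp: sup_dist_def)
  show "sup_dist f g = 0 \<longleftrightarrow> f = g" if "f \<in> A_u" "g \<in> A_u" for f g :: "'a \<Rightarrow> 'b"
  proof
    assume "sup_dist f g = 0"
    then have "f x = g x" if "x \<in> ball 0 1" for x using le [OF \<open>f \<in> A_u\<close> \<open>g \<in> A_u\<close> that] by simp
    with that show "f = g" by (intro extensionalityI [of _ "ball 0 1"]) (auto simp: A_u_def)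
  qed (simp add: sup_dist_def sup_norm_def)
  show "sup_dist f h \<le> sup_dist f g + sup_dist g h"
    if "f \<in> A_u" "g \<in> A_u" "h \<in> A_u" for f g h :: "'a \<Rightarrow> 'b"
  proof -
    have "(SUP x\<in>ball 0 1. norm (f x - h x)) \<le> sup_dist f g + sup_dist g h"
    proof (rule cSUP_least)
      fix x :: 'a assume "x \<in> ball 0 1"
      with that show "norm (f x - h x) \<le> sup_dist f g + sup_dist g h"
        using le [of f g x] le [of g h x] norm_triangle_ineq [of "f x - g x" "g x - h x"] by simp
    qed simp
    with that show ?thesis by (simp add: sup_dist_def [of f h] sup_norm_def)
  qed
qed

end

theory Submission imports Defs begin

text \<open>Replacing \<open>f\<close> by \<open>exp p \<cdot> f\<close> with a small complex-linear functional \<open>p\<close> keeps it in \<open>A_u\<close>,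
  changes it little in the sup norm, and adds the real-linear functional \<open>Re p\<close> to the function
  \<open>\<phi> x = ln ((1 - \<parallel>x\<parallel>\<^sup>2) * \<parallel>f x\<parallel>)\<close>. By Stegall's variational principle the functionals \<open>u\<close> for which
  all maximizing sequences of \<open>\<phi> + u\<close> converge are dense: those for which the near-maximizers lie
  in a small ball form an open set, which is dense by uniform convexity, and Baire's
  theorem applies. The limit lies in the open ball because the weight vanishes on the sphere.\<close>

section \<open>Sublinear functionals and the Hahn-Banach theorem\<close>

text \<open>Homogeneity is demanded only as an inequality, since infima inherit that form directly;
  applying it to 1/c as well recovers equality in \<open>sublinear_scale\<close>.\<close>

definition sublinear :: "('a::real_vector \<Rightarrow> real) \<Rightarrow> bool" where
  "sublinear q \<longleftrightarrow> (\<forall>x y. q (x + y) \<le> q x + q y) \<and> (\<forall>c>0. \<forall>x. q (c *\<^sub>R x) \<le> c * q x)"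

lemma sublinear_add: "sublinear q \<Longrightarrow> q (x + y) \<le> q x + q y"
  and sublinear_scale_le: "sublinear q \<Longrightarrow> c > 0 \<Longrightarrow> q (c *\<^sub>R x) \<le> c * q x"
  by (auto simp: sublinear_def)

lemma sublinear_zero:
  assumes "sublinear q" shows "q 0 = 0"
  using sublinear_add [OF assms, of 0 0] sublinear_scale_le [OF assms, of "1/2" 0] by simp

lemma sublinear_scale:
  assumes "sublinear q" "c \<ge> 0" shows "q (c *\<^sub>R x) = c * q x"
proof (cases "c = 0")
  case False
  with assms have c: "c > 0" by simp
  have "q x \<le> (1/c) * q (c *\<^sub>R x)"
    using sublinear_scale_le [OF assms(1), of "1/c" "c *\<^sub>R x"] c by simp
  then show ?thesis
    using sublinear_scale_le [OF assms(1) c, of x] c by (simp add: field_simps)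
qed (simp add: sublinear_zero assms)

lemma sublinear_minus_le:
  assumes "sublinear q" shows "- q (- x) \<le> q x"
  using sublinear_add [OF assms, of x "-x"] sublinear_zero [OF assms] by simp

text \<open>The infimum of \<open>q (x + t *\<^sub>R y) - t * q y\<close> over
  \<open>t \<ge> 0\<close> works: t = 0 puts it below q, and t = 1 gives the value at -y. It serves
  both to show that minimal functionals are odd and to prescribe the value of a supporting
  functional.\<close>

lemma sublinear_shift:
  assumes q: "sublinear q"
  obtains r where "sublinear r" "\<And>x. r x \<le> q x" "r (- y) \<le> - q y"
proof
  define r where "r x = (INF t\<in>{0..}. q (x + t *\<^sub>R y) - t * q y)" for x
  have bdd: "bdd_below ((\<lambda>t. q (x + t *\<^sub>R y) - t * q y) ` {0..})" for x
  proof (rule bdd_belowI2)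
    fix t :: real assume "t \<in> {0..}"
    then show "- q (- x) \<le> q (x + t *\<^sub>R y) - t * q y"
      using sublinear_add [OF q, of "x + t *\<^sub>R y" "- x"] sublinear_scale [OF q, of t y] by simp
  qed
  have le: "r x \<le> q (x + t *\<^sub>R y) - t * q y" if "t \<ge> 0" for x t
    unfolding r_def using that by (intro cINF_lower [OF bdd]) auto
  have ge: "a \<le> r x" if "\<And>t. t \<ge> 0 \<Longrightarrow> a \<le> q (x + t *\<^sub>R y) - t * q y" for a x
    unfolding r_def using that by (intro cINF_greatest) auto
  show "r x \<le> q x" for x using le [of 0 x] by simp
  show "r (- y) \<le> - q y" using le [of 1 "-y"] sublinear_zero [OF q] by simp
  show "sublinear r"
    unfolding sublinear_def
  proof (intro conjI allI impI)
    fix x x'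
    \<comment> \<open>The parameter s + t is admissible for x + x'. Taking the infimum over s and
      then over t splits the estimate into the two summands.\<close>
    have "r (x + x') - (q (x' + t *\<^sub>R y) - t * q y) \<le> r x" if t: "t \<ge> 0" for t
    proof (rule ge)
      fix s :: real assume s: "s \<ge> 0"
      have "q ((x + x') + (s + t) *\<^sub>R y) \<le> q (x + s *\<^sub>R y) + q (x' + t *\<^sub>R y)"
        using sublinear_add [OF q, of "x + s *\<^sub>R y" "x' + t *\<^sub>R y"]
        by (simp add: algebra_simps)
      then show "r (x + x') - (q (x' + t *\<^sub>R y) - t * q y) \<le> q (x + s *\<^sub>R y) - s * q y"
        using le [of "s + t" "x + x'"] s t by (simp add: algebra_simps)
    qed
    then have "r (x + x') - r x \<le> r x'" by (intro ge) (simp add: algebra_simps)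
    then show "r (x + x') \<le> r x + r x'" by simp
  next
    fix c :: real and x assume c: "c > 0"
    have "r (c *\<^sub>R x) / c \<le> r x"
    proof (rule ge)
      fix t :: real assume "t \<ge> 0"
      then have "r (c *\<^sub>R x) \<le> q (c *\<^sub>R (x + t *\<^sub>R y)) - c * t * q y"
        using le [of "c * t" "c *\<^sub>R x"] c by (simp add: scaleR_add_right)
      also have "\<dots> = c * (q (x + t *\<^sub>R y) - t * q y)"
        using c sublinear_scale [OF q, of c "x + t *\<^sub>R y"] by (simp add: algebra_simps)
      finally show "r (c *\<^sub>R x) / c \<le> q (x + t *\<^sub>R y) - t * q y"
        using c by (simp add: field_simps)
    qed
    then show "r (c *\<^sub>R x) \<le> c * r x" using c by (simp add: field_simps)
  qed
qed

text \<open>This supplies the lower bounds for Zorn's lemma. The infimum is finite because every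
  member is at least -p(-x) at x, and it is subadditive because any two members have a common lower
  bound in the chain, namely the smaller one.\<close>

lemma sublinear_chain_INF:
  assumes C: "C \<noteq> {}" "\<And>q. q \<in> C \<Longrightarrow> sublinear q" "\<And>q. q \<in> C \<Longrightarrow> q \<le> p"
    and chain: "\<And>q r. q \<in> C \<Longrightarrow> r \<in> C \<Longrightarrow> q \<le> r \<or> r \<le> q"
  shows "sublinear (\<lambda>x. INF q\<in>C. q x)" and "q \<in> C \<Longrightarrow> (INF q\<in>C. q x) \<le> q x"
proof -
  have bdd: "bdd_below ((\<lambda>q. q x) ` C)" for x
  proof (rule bdd_belowI2)
    fix q assume q: "q \<in> C"
    show "- p (- x) \<le> q x" using sublinear_minus_le [OF C(2) [OF q], of x] le_funD [OF C(3) [OF q], of "-x"] by simp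
  qed
  show le: "(INF q\<in>C. q x) \<le> q x" if "q \<in> C" for q x
    using that by (intro cINF_lower [OF bdd])
  have ge: "a \<le> (INF q\<in>C. q x)" if "\<And>q. q \<in> C \<Longrightarrow> a \<le> q x" for a x
    using that C(1) by (intro cINF_greatest) auto
  show "sublinear (\<lambda>x. INF q\<in>C. q x)"
    unfolding sublinear_def
  proof (intro conjI allI impI)
    fix x y
    have *: "(INF q\<in>C. q (x + y)) \<le> q x + r y" if q: "q \<in> C" and r: "r \<in> C" for q r
    proof -
      from chain [OF q r] obtain s where s: "s \<in> C" "s \<le> q" "s \<le> r" using q r by blast
      then show ?thesis
        using le [of s "x + y"] sublinear_add [OF C(2) [OF s(1)], of x y]
          le_funD [of s q x] le_funD [of s r y] by linarith
    qed
    have "(INF q\<in>C. q (x + y)) - r y \<le> (INF q\<in>C. q x)" if r: "r \<in> C" for r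
      using * [OF _ r] by (intro ge) (simp add: algebra_simps)
    then have "(INF q\<in>C. q (x + y)) - (INF q\<in>C. q x) \<le> (INF q\<in>C. q y)"
      by (intro ge) (simp add: algebra_simps)
    then show "(INF q\<in>C. q (x + y)) \<le> (INF q\<in>C. q x) + (INF q\<in>C. q y)" by simp
  next
    fix c :: real and x assume c: "c > 0"
    have "(INF q\<in>C. q (c *\<^sub>R x)) / c \<le> (INF q\<in>C. q x)"
    proof (rule ge)
      fix q assume q: "q \<in> C"
      show "(INF q\<in>C. q (c *\<^sub>R x)) / c \<le> q x"
        using le [OF q, of "c *\<^sub>R x"] sublinear_scale_le [OF C(2) [OF q] c, of x] c
        by (simp add: field_simps)
    qed
    then show "(INF q\<in>C. q (c *\<^sub>R x)) \<le> c * (INF q\<in>C. q x)" using c by (simp add: field_simps)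
  qed
qed

text \<open>A minimal sublinear functional is linear, which turns Zorn's lemma into the
  Hahn--Banach theorem.\<close>

lemma minimal_sublinear_linear:
  assumes q: "sublinear q" and min: "\<And>r. sublinear r \<Longrightarrow> r \<le> q \<Longrightarrow> r = q"
  shows "linear q"
proof -
  have minus: "q (- y) = - q y" for y
  proof -
    obtain r where "sublinear r" "\<And>x. r x \<le> q x" "r (- y) \<le> - q y"
      using sublinear_shift [OF q] by metis
    with min [of r] have "q (- y) \<le> - q y" by (auto simp: le_fun_def)
    with sublinear_minus_le [OF q, of "-y"] show ?thesis by simp
  qed
  show ?thesis
  proof (rule linearI)
    show "q (x + y) = q x + q y" for x y
      using sublinear_add [OF q, of x y] sublinear_add [OF q, of "- x" "- y"]
        minus [of x] minus [of y] minus [of "x + y"] by simp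
    show "q (c *\<^sub>R x) = c *\<^sub>R q x" for c x
    proof (cases "c \<ge> 0")
      case False
      then show ?thesis using sublinear_scale [OF q, of "- c" x] minus [of "c *\<^sub>R x"] by simp
    qed (simp add: sublinear_scale [OF q])
  qed
qed

lemma exists_linear_le_sublinear:
  assumes p: "sublinear p"
  obtains q where "linear q" "\<And>x. q x \<le> p x"
proof -
  define A where "A = {q. sublinear q \<and> q \<le> p}"
  \<comment> \<open>The order is reversed, so that the maximal element from Zorn's lemma is a
    minimal sublinear functional.\<close>
  have "\<exists>m\<in>A. \<forall>a\<in>A. a \<le> m \<longrightarrow> a = m"
  proof (rule predicate_Zorn)
    show "partial_order_on A (relation_of (\<lambda>q r. r \<le> q) A)"
      by (rule partial_order_on_relation_ofI) auto
    fix C assume "C \<in> Chains (relation_of (\<lambda>q r. r \<le> q) A)"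
    then have C: "\<And>q r. q \<in> C \<Longrightarrow> r \<in> C \<Longrightarrow> q \<in> A \<and> r \<in> A \<and> (q \<le> r \<or> r \<le> q)"
      by (auto simp: Chains_def relation_of_def)
    show "\<exists>u\<in>A. \<forall>a\<in>C. u \<le> a"
    proof (cases "C = {}")
      case True
      with p show ?thesis by (auto simp: A_def)
    next
      case False
      then obtain q0 where q0: "q0 \<in> C" by blast
      have 1: "\<And>q. q \<in> C \<Longrightarrow> sublinear q" "\<And>q. q \<in> C \<Longrightarrow> q \<le> p"
        using C by (auto simp: A_def)
      let ?m = "\<lambda>x. INF q\<in>C. q x"
      have le: "?m \<le> q" if "q \<in> C" for q
        using sublinear_chain_INF(2) [OF False 1 _ that] C unfolding le_fun_def by blast
      moreover have "sublinear ?m"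
        using sublinear_chain_INF(1) [OF False 1] C by blast
      moreover have "?m \<le> p" using le [OF q0] C [OF q0 q0] by (auto simp: A_def)
      ultimately show ?thesis unfolding A_def by blast
    qed
  qed
  then obtain m where m: "m \<in> A" "\<And>a. a \<in> A \<Longrightarrow> a \<le> m \<Longrightarrow> a = m" by blast
  have "linear m"
    using m by (intro minimal_sublinear_linear) (auto simp: A_def intro: order_trans)
  with m(1) that show thesis by (auto simp: A_def le_fun_def)
qed

text \<open>Shifting the norm along x0 before applying Hahn-Banach gives a linear q below the norm
  with q(-x0) at most -norm x0. Linearity turns this into equality at x0.\<close>

lemma supporting_functional:
  fixes x0 :: "'a::real_normed_vector"
  obtains p :: "'a \<Rightarrow>\<^sub>L real" where "blinfun_apply p x0 = norm x0" "\<And>x. \<bar>blinfun_apply p x\<bar> \<le> norm x"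
proof -
  have "sublinear (norm :: 'a \<Rightarrow> real)" by (auto simp: sublinear_def norm_triangle_ineq)
  then obtain r :: "'a \<Rightarrow> real" where r: "sublinear r" "\<And>x. r x \<le> norm x" "r (- x0) \<le> - norm x0"
    using sublinear_shift by blast
  obtain q where q: "linear q" "\<And>x. q x \<le> r x"
    using exists_linear_le_sublinear [OF r(1)] by blast
  have minus: "q (- x) = - q x" for x by (rule linear_neg [OF q(1)])
  have le: "q x \<le> norm x" for x using q(2) [of x] r(2) [of x] by simp
  have abs: "\<bar>q x\<bar> \<le> norm x" for x using le [of x] le [of "- x"] minus [of x] by simp
  have bl: "bounded_linear q"
    using q(1) abs by (auto simp: bounded_linear_def bounded_linear_axioms_def intro!: exI [of _ 1])
  have "q x0 = norm x0" using q(2) [of "- x0"] r(3) minus [of x0] le [of x0] by simp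
  with bl abs that [of "Blinfun q"] show thesis by (simp add: bounded_linear_Blinfun_apply)
qed

section \<open>Uniform convexity off the unit sphere\<close>

text \<open>Both vectors are multiples of x, so the error of replacing radial projection by the
  common scaling 1/T is computed exactly.\<close>

lemma norm_normalize_diff:
  fixes x :: "'a::real_normed_vector"
  assumes "x \<noteq> 0" "norm x \<le> T"
  shows "norm ((1 / norm x) *\<^sub>R x - (1 / T) *\<^sub>R x) = 1 - norm x / T"
proof -
  have x: "norm x > 0" and T: "T > 0" using assms less_le_trans [of 0 "norm x" T] by auto
  have "norm ((1 / norm x) *\<^sub>R x - (1 / T) *\<^sub>R x) = \<bar>1 / norm x - 1 / T\<bar> * norm x"
    by (simp flip: scaleR_left_diff_distrib)
  also have "1 / norm x - 1 / T \<ge> 0" using assms x T by (simp add: field_simps)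
  then have "\<bar>1 / norm x - 1 / T\<bar> * norm x = 1 - norm x / T"
    using x T by (simp add: field_simps)
  finally show ?thesis .
qed

text \<open>The hypotheses do not bound \<open>R\<close> away from 0: when \<open>R\<close> is small compared with \<open>r\<close>, the
  triangle inequality suffices, and otherwise the points can be moved to the unit sphere.\<close>

lemma uniformly_convex_diff_less:
  fixes r :: real
  assumes uc: "uniformly_convex TYPE('a::real_normed_vector)" and r: "r > 0"
  obtains \<delta> where "\<delta> > 0" "\<delta> \<le> 1"
    "\<And>R x y :: 'a. R \<le> 1 \<Longrightarrow> norm x \<le> R + \<delta> \<Longrightarrow> norm y \<le> R + \<delta> \<Longrightarrow>
      2 * R - 4 * \<delta> \<le> norm (x + y) \<Longrightarrow> norm (x - y) < r"
proof -
  obtain d where d: "d > 0" "\<And>x y :: 'a. norm x = 1 \<Longrightarrow> norm y = 1 \<Longrightarrow> norm (x - y) \<ge> r / 4 \<Longrightarrow>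
      norm ((1/2) *\<^sub>R (x + y)) \<le> 1 - d"
    using uc r unfolding uniformly_convex_def by (metis divide_pos_pos zero_less_numeral)
  \<comment> \<open>The term r * d / 100 makes the error 3 s / 2 below smaller than d; the term r /
    400 keeps T - 6 \<delta> positive and the final error 12 \<delta> below r / 2.\<close>
  define \<delta> where "\<delta> = min 1 (min (r / 400) (r * d / 100))"
  have \<delta>: "\<delta> > 0" "\<delta> \<le> 1" "\<delta> \<le> r / 400" "\<delta> \<le> r * d / 100"
    using r d(1) by (auto simp: \<delta>_def)
  have "norm (x - y) < r"
    if R: "R \<le> 1" and x: "norm x \<le> R + \<delta>" and y: "norm y \<le> R + \<delta>"
      and xy: "2 * R - 4 * \<delta> \<le> norm (x + y)" for R and x y :: 'a
  proof (cases "R + \<delta> < r / 4")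
    case True
    then show ?thesis using norm_triangle_ineq4 [of x y] x y r by linarith
  next
    case False
    define T where "T = R + \<delta>"
    have T: "T \<ge> r / 4" "T > 0" "T \<le> 2" using False r R \<delta> by (auto simp: T_def)
    \<comment> \<open>Each norm is at least norm (x + y) minus the other norm, hence at least R - 5
      \<delta> = T - 6 \<delta>.\<close>
    have low: "norm x \<ge> T - 6 * \<delta>" "norm y \<ge> T - 6 * \<delta>"
      using norm_triangle_ineq [of x y] x y xy by (auto simp: T_def)
    have "T - 6 * \<delta> > 0" using T \<delta> r by linarith
    then have nz: "x \<noteq> 0" "y \<noteq> 0" using low by auto
    define s where "s = 6 * \<delta> / T"
    have "s \<le> 6 * \<delta> / (r / 4)"
      unfolding s_def using T \<delta> r by (intro divide_left_mono) auto
    then have "s * r \<le> 24 * \<delta>" using r by (simp add: field_simps)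
    moreover have "(24 * d / 100) * r = 24 * (r * d / 100)" by simp
    ultimately have "s * r \<le> (6/100) * r" "s * r \<le> (24 * d / 100) * r"
      using \<delta>(3,4) by linarith+
    then have s: "s \<le> 6/100" "s \<le> 24 * d / 100" using r by (blast intro: mult_right_le_imp_le)+
    have near: "norm ((1 / norm z) *\<^sub>R z - (1 / T) *\<^sub>R z) \<le> s"
      if "z \<noteq> 0" "norm z \<le> T" "norm z \<ge> T - 6 * \<delta>" for z :: 'a
      using norm_normalize_diff [OF that(1,2)] that(3) T(2) by (simp add: s_def field_simps)
    define x' y' where "x' = (1 / norm x) *\<^sub>R x" and "y' = (1 / norm y) *\<^sub>R y"
    have nx: "norm (x' - (1 / T) *\<^sub>R x) \<le> s" and ny: "norm (y' - (1 / T) *\<^sub>R y) \<le> s"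
      using near nz low x y by (auto simp: x'_def y'_def T_def)
    have "norm x' = 1" "norm y' = 1" using nz by (auto simp: x'_def y'_def)
    \<comment> \<open>Since 2 R - 4 \<delta> = 2 T - 6 \<delta>, scaling by 1/T loses one s;
      normalizing x and y loses one more each.\<close>
    moreover have "norm (x' + y') \<ge> 2 - 3 * s"
    proof -
      have "2 - s = (2 * R - 4 * \<delta>) / T" using T(2) by (simp add: s_def T_def field_simps)
      also have "\<dots> \<le> norm (x + y) / T" using xy T(2) by (simp add: divide_right_mono)
      also have "\<dots> = norm ((1 / T) *\<^sub>R (x + y))" using T(2) by simp
      finally have "2 - s \<le> norm ((1 / T) *\<^sub>R (x + y))" .
      moreover have "norm ((1 / T) *\<^sub>R (x + y)) \<le> norm (x' + y') + norm ((x' - (1 / T) *\<^sub>R x) + (y' - (1 / T) *\<^sub>R y))"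
        using norm_triangle_ineq4 [of "x' + y'" "(x' - (1 / T) *\<^sub>R x) + (y' - (1 / T) *\<^sub>R y)"]
        by (simp add: algebra_simps)
      ultimately show ?thesis
        using norm_triangle_ineq [of "x' - (1 / T) *\<^sub>R x" "y' - (1 / T) *\<^sub>R y"] nx ny by linarith
    qed
    then have "norm ((1/2) *\<^sub>R (x' + y')) > 1 - d" using s d(1) by simp
    ultimately have "norm (x' - y') < r / 4" using d(2) [of x' y'] by linarith
    moreover have "norm ((1 / T) *\<^sub>R (x - y)) \<le> norm (x' - y') + norm ((x' - (1 / T) *\<^sub>R x) - (y' - (1 / T) *\<^sub>R y))"
      using norm_triangle_ineq4 [of "x' - y'" "(x' - (1 / T) *\<^sub>R x) - (y' - (1 / T) *\<^sub>R y)"]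
      by (simp add: algebra_simps)
    ultimately have "norm ((1 / T) *\<^sub>R (x - y)) < r / 4 + 2 * s"
      using norm_triangle_ineq4 [of "x' - (1 / T) *\<^sub>R x" "y' - (1 / T) *\<^sub>R y"] nx ny by linarith
    then have "norm (x - y) / T < r / 4 + 2 * s" using T(2) by simp
    then have "norm (x - y) < T * (r / 4) + 2 * (s * T)" using T(2) by (simp add: field_simps)
    moreover have "s * T = 6 * \<delta>" using T by (simp add: s_def)
    moreover have "T * (r / 4) \<le> 2 * (r / 4)" using T r by (intro mult_right_mono) auto
    ultimately show ?thesis using \<delta>(3) r by linarith
  qed
  with \<delta> that show thesis by blast
qed

section \<open>Near-maximizers and the variational principle\<close>

text \<open>Comparing with every point of D expresses being within \<tau> of the supremum without
  naming the supremum, so boundedness is needed only for nonemptiness.\<close>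

definition near_max :: "('a::real_normed_vector \<Rightarrow> real) \<Rightarrow> 'a set \<Rightarrow> ('a \<Rightarrow>\<^sub>L real) \<Rightarrow> real \<Rightarrow> 'a set" where
  "near_max \<phi> D u \<tau> = {x \<in> D. \<forall>z\<in>D. \<phi> z + blinfun_apply u z \<le> \<phi> x + blinfun_apply u x + \<tau>}"

lemma blinfun_apply_le_norm:
  assumes "norm x \<le> 1" shows "\<bar>blinfun_apply u x\<bar> \<le> norm u"
  using norm_blinfun [of u x] mult_left_mono [OF assms norm_ge_zero [of u]] by simp

lemma near_max_nonempty:
  fixes \<phi> :: "'a::real_normed_vector \<Rightarrow> real"
  assumes "D \<noteq> {}" "D \<subseteq> cball 0 1" "bdd_above (\<phi> ` D)" "\<tau> > 0"
  shows "near_max \<phi> D u \<tau> \<noteq> {}"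
proof -
  obtain B where B: "\<And>x. x \<in> D \<Longrightarrow> \<phi> x \<le> B" using assms(3) by (auto simp: bdd_above_def)
  have bdd: "bdd_above ((\<lambda>x. \<phi> x + blinfun_apply u x) ` D)"
  proof (rule bdd_aboveI2)
    fix x assume "x \<in> D"
    then show "\<phi> x + blinfun_apply u x \<le> B + norm u"
      using B [of x] assms(2) blinfun_apply_le_norm [of x u] by force
  qed
  obtain x where x: "x \<in> D" "(SUP x\<in>D. \<phi> x + blinfun_apply u x) - \<tau> < \<phi> x + blinfun_apply u x"
    using less_cSUP_iff [OF assms(1) bdd, of "(SUP x\<in>D. \<phi> x + blinfun_apply u x) - \<tau>"] assms(4) by auto
  have "x \<in> near_max \<phi> D u \<tau>"
    using x cSUP_upper [OF _ bdd] by (force simp: near_max_def)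
  then show ?thesis by blast
qed

text \<open>On the unit ball u and v differ by at most \<sigma>, and a comparison evaluates them at
  two points, whence 2 \<sigma>. With u = v and \<sigma> = 0 this is monotonicity in the
  tolerance.\<close>

lemma near_max_perturb:
  assumes "D \<subseteq> cball 0 1" "norm (v - u) \<le> \<sigma>" "\<tau> + 2 * \<sigma> \<le> \<rho>"
  shows "near_max \<phi> D v \<tau> \<subseteq> near_max \<phi> D u \<rho>"
proof
  fix x assume x: "x \<in> near_max \<phi> D v \<tau>"
  have *: "\<bar>blinfun_apply v z - blinfun_apply u z\<bar> \<le> \<sigma>" if "z \<in> D" for z
    using blinfun_apply_le_norm [of z "v - u"] that assms(1,2) by (force simp: blinfun.diff_left)
  have "\<phi> z + blinfun_apply u z \<le> \<phi> x + blinfun_apply u x + \<rho>" if z: "z \<in> D" for z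
    using x z * [OF z] * [of x] assms(3) by (force simp: near_max_def)
  with x show "x \<in> near_max \<phi> D u \<rho>" by (simp add: near_max_def)
qed

text \<open>These are the sets for the Baire argument: if u belongs to them for all r > 0, every
  maximizing sequence of the tilted function is Cauchy.\<close>

definition max_localized :: "('a::real_normed_vector \<Rightarrow> real) \<Rightarrow> 'a set \<Rightarrow> real \<Rightarrow> ('a \<Rightarrow>\<^sub>L real) set" where
  "max_localized \<phi> D r = {u. \<exists>\<tau>>0. \<forall>x\<in>near_max \<phi> D u \<tau>. \<forall>y\<in>near_max \<phi> D u \<tau>. dist x y < r}"

lemma open_max_localized:
  assumes "D \<subseteq> cball 0 1"
  shows "open (max_localized \<phi> D r)"
  unfolding open_dist
proof
  fix u assume "u \<in> max_localized \<phi> D r"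
  then obtain \<tau> where \<tau>: "\<tau> > 0"
    "\<forall>x\<in>near_max \<phi> D u \<tau>. \<forall>y\<in>near_max \<phi> D u \<tau>. dist x y < r"
    by (auto simp: max_localized_def)
  have "v \<in> max_localized \<phi> D r" if "dist v u < \<tau> / 4" for v
  proof -
    \<comment> \<open>The tolerances add up: \<tau> / 2 + 2 * (\<tau> / 4) = \<tau>.\<close>
    have "near_max \<phi> D v (\<tau> / 2) \<subseteq> near_max \<phi> D u \<tau>"
      using that by (intro near_max_perturb [OF assms, of _ _ "\<tau> / 4"]) (auto simp: dist_norm)
    with \<tau> show ?thesis unfolding max_localized_def by (auto intro!: exI [of _ "\<tau> / 2"])
  qed
  with \<tau>(1) show "\<exists>e>0. \<forall>v. dist v u < e \<longrightarrow> v \<in> max_localized \<phi> D r"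
    by (intro exI [of _ "\<tau> / 4"]) auto
qed

text \<open>Let \<open>R\<close> be the limit of the radii of the sets of near-maximizers.  Tilting by a small multiple
  of a functional that supports a near-maximizer of norm close to \<open>R\<close> leaves only near-maximizers
  on which this functional is close to \<open>R\<close>; these are close to each other by uniform convexity.\<close>

lemma max_localized_dense:
  fixes \<phi> :: "'a::real_normed_vector \<Rightarrow> real"
  assumes uc: "uniformly_convex TYPE('a)"
    and D: "D \<noteq> {}" "D \<subseteq> cball 0 1" "bdd_above (\<phi> ` D)"
    and r: "r > 0" and e: "e > 0"
  obtains v where "v \<in> max_localized \<phi> D r" "dist v u < e"
proof -
  obtain \<delta> where \<delta>: "\<delta> > 0" "\<delta> \<le> 1"
    "\<And>R x y :: 'a. R \<le> 1 \<Longrightarrow> norm x \<le> R + \<delta> \<Longrightarrow> norm y \<le> R + \<delta> \<Longrightarrow>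
      2 * R - 4 * \<delta> \<le> norm (x + y) \<Longrightarrow> norm (x - y) < r"
    using uniformly_convex_diff_less [OF uc r] by blast
  define radii where "radii = {\<rho>. \<exists>\<tau>>0. \<forall>x\<in>near_max \<phi> D u \<tau>. norm x \<le> \<rho>}"
  define R where "R = Inf radii"
  have one: "1 \<in> radii"
    using D(2) by (auto simp: radii_def near_max_def subset_iff intro!: exI [of _ 1])
  have "0 \<le> \<rho>" if \<rho>: "\<rho> \<in> radii" for \<rho>
  proof -
    obtain \<tau> where \<tau>: "\<tau> > 0" "\<forall>x\<in>near_max \<phi> D u \<tau>. norm x \<le> \<rho>"
      using \<rho> by (auto simp: radii_def)
    obtain x where "x \<in> near_max \<phi> D u \<tau>" using near_max_nonempty [OF D \<tau>(1)] by blast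
    with \<tau>(2) show ?thesis using norm_ge_zero order_trans by blast
  qed
  then have bdd: "bdd_below radii" by (rule bdd_belowI)
  have R1: "R \<le> 1" unfolding R_def by (rule cInf_lower [OF one bdd])
  obtain \<rho> where "\<rho> \<in> radii" "\<rho> < R + \<delta>"
    using cInf_less_iff [of radii "R + \<delta>"] bdd one \<delta>(1) by (auto simp: R_def)
  then obtain \<tau>1 where \<tau>1: "\<tau>1 > 0" "\<And>x. x \<in> near_max \<phi> D u \<tau>1 \<Longrightarrow> norm x \<le> R + \<delta>"
    unfolding radii_def by fastforce
  have far: "\<exists>x\<in>near_max \<phi> D u \<tau>. norm x > R - \<delta>" if "\<tau> > 0" for \<tau>
  proof (rule ccontr)
    assume "\<not> ?thesis"
    then have "R - \<delta> \<in> radii" using that by (auto simp: radii_def not_less)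
    then have "R \<le> R - \<delta>" unfolding R_def by (rule cInf_lower [OF _ bdd])
    with \<delta>(1) show False by simp
  qed
  \<comment> \<open>The bound e / 2 keeps v close to u. The bound \<tau>1 / 3 gives \<eta> + 2
    \<epsilon> \<le> \<tau>1, so near-maximizers for v are near-maximizers for u and have norm at
    most R + \<delta>.\<close>
  define \<epsilon> where "\<epsilon> = min (e / 2) (\<tau>1 / 3)"
  have \<epsilon>: "\<epsilon> > 0" "\<epsilon> < e" "3 * \<epsilon> \<le> \<tau>1" using e \<tau>1 by (auto simp: \<epsilon>_def)
  \<comment> \<open>Two tolerances \<eta> add up to \<epsilon> * \<delta>, which becomes a loss of
    only \<delta> after division by \<epsilon>.\<close>
  define \<eta> where "\<eta> = \<epsilon> * \<delta> / 2"
  have \<eta>: "\<eta> > 0" "\<eta> \<le> \<epsilon>" using \<epsilon> \<delta> by (auto simp: \<eta>_def mult_le_cancel_left1)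
  obtain x0 where x0: "x0 \<in> near_max \<phi> D u \<eta>" "norm x0 > R - \<delta>" using far [OF \<eta>(1)] by blast
  obtain p :: "'a \<Rightarrow>\<^sub>L real" where p: "blinfun_apply p x0 = norm x0" "\<And>x. \<bar>blinfun_apply p x\<bar> \<le> norm x"
    using supporting_functional [of x0] by blast
  have np: "norm p \<le> 1" using p(2) by (intro norm_blinfun_bound) auto
  define v where "v = u + \<epsilon> *\<^sub>R p"
  have vu: "norm (v - u) \<le> \<epsilon>" using np \<epsilon>(1) by (simp add: v_def mult_left_le)
  have sub: "near_max \<phi> D v \<eta> \<subseteq> near_max \<phi> D u \<tau>1"
    using near_max_perturb [OF D(2) vu] \<epsilon>(3) \<eta>(2) by simp
  \<comment> \<open>Near-maximality of x0 for u and of x for v are added; \<phi> and u cancel,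
    leaving a comparison of p at x0 and x.\<close>
  have large: "blinfun_apply p x > R - 2 * \<delta>" if x: "x \<in> near_max \<phi> D v \<eta>" for x
  proof -
    have xD: "x \<in> D" and x0D: "x0 \<in> D" using x x0 by (auto simp: near_max_def)
    have "\<phi> x + blinfun_apply u x \<le> \<phi> x0 + blinfun_apply u x0 + \<eta>"
      using x0(1) xD by (simp add: near_max_def)
    moreover have "\<phi> x0 + blinfun_apply v x0 \<le> \<phi> x + blinfun_apply v x + \<eta>"
      using x x0D by (simp add: near_max_def)
    then have "\<phi> x0 + (blinfun_apply u x0 + \<epsilon> * norm x0) \<le> \<phi> x + (blinfun_apply u x + \<epsilon> * blinfun_apply p x) + \<eta>"
      using p(1) by (simp add: v_def blinfun.add_left blinfun.scaleR_left)
    ultimately have "\<epsilon> * norm x0 \<le> \<epsilon> * blinfun_apply p x + \<epsilon> * \<delta>" by (simp add: \<eta>_def)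
    then have "\<epsilon> * norm x0 \<le> \<epsilon> * (blinfun_apply p x + \<delta>)" by (simp add: algebra_simps)
    then have "norm x0 \<le> blinfun_apply p x + \<delta>" using \<epsilon>(1) by simp
    with x0(2) show ?thesis by simp
  qed
  have "dist x y < r" if x: "x \<in> near_max \<phi> D v \<eta>" and y: "y \<in> near_max \<phi> D v \<eta>" for x y
  proof -
    have "2 * R - 4 * \<delta> \<le> norm (x + y)"
      using large [OF x] large [OF y] p(2) [of "x + y"] by (simp add: blinfun.add_right)
    then show ?thesis
      unfolding dist_norm using x y sub \<tau>1(2) by (intro \<delta>(3) [OF R1]) auto
  qed
  then have "v \<in> max_localized \<phi> D r" using \<eta>(1) by (auto simp: max_localized_def)
  moreover have "dist v u < e" using vu \<epsilon>(2) by (simp add: dist_norm)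
  ultimately show thesis by (rule that)
qed

lemma exists_small_max_localized:
  fixes \<phi> :: "'a::real_normed_vector \<Rightarrow> real"
  assumes uc: "uniformly_convex TYPE('a)"
    and D: "D \<noteq> {}" "D \<subseteq> cball 0 1" "bdd_above (\<phi> ` D)"
    and e: "e > 0"
  obtains u where "norm u < e" "\<And>r. r > 0 \<Longrightarrow> u \<in> max_localized \<phi> D r"
proof -
  let ?G = "\<lambda>n::nat. max_localized \<phi> D (inverse (real (Suc n)))"
  have "closure (?G n) = UNIV" for n
  proof -
    have "u \<in> closure (?G n)" for u
      unfolding closure_approachable
      using max_localized_dense [OF uc D, of "inverse (real (Suc n))" _ u]
      by (metis inverse_positive_iff_positive of_nat_0_less_iff zero_less_Suc)
    then show ?thesis by blast
  qed
  \<comment> \<open>The bounded real functionals form a complete space, so the countable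
    intersection of open dense sets is dense; density is then used near 0.\<close>
  then have "Met_TC.mtopology closure_of \<Inter>(range ?G) = (UNIV :: ('a \<Rightarrow>\<^sub>L real) set)"
    using open_max_localized [OF D(2)]
    by (intro Met_TC.metric_Baire_category) (auto simp: complete_UNIV)
  then have "0 \<in> closure (\<Inter>(range ?G))" by simp
  then obtain u where u: "u \<in> \<Inter>(range ?G)" "dist u 0 < e"
    using e unfolding closure_approachable by blast
  show thesis
  proof
    show "norm u < e" using u(2) by simp
    fix r :: real assume "r > 0"
    then obtain n where "inverse (real (Suc n)) < r" using reals_Archimedean by blast
    moreover have "u \<in> ?G n" using u(1) by blast
    ultimately show "u \<in> max_localized \<phi> D r"
      by (auto simp: max_localized_def intro: less_trans)
  qed
qed

text \<open>Passing to ln w on the set where w is positive turns the factor exp(u) into the summand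
  u. Near-maximizers with tolerances tending to 0 form a Cauchy sequence, and continuity of w makes
  its limit a maximizer.\<close>

lemma exists_tilt_attaining_max:
  fixes w :: "'a::banach \<Rightarrow> real"
  assumes uc: "uniformly_convex TYPE('a)"
    and w: "continuous_on UNIV w" "\<And>x. 0 \<le> w x" "\<And>x. w x \<le> B"
      "\<And>x. norm x \<ge> 1 \<Longrightarrow> w x = 0"
    and e: "e > 0"
  obtains u x0 where "norm u < e" "norm x0 < 1"
    "\<And>x. w x * exp (blinfun_apply u x) \<le> w x0 * exp (blinfun_apply u x0)"
proof (cases "\<exists>x. w x > 0")
  case False
  with w(2) have "w x = 0" for x by (metis order_le_less)
  with e that [of 0 0] show thesis by simp
next
  case True
  then obtain a where a: "w a > 0" ..
  define D where "D = {x. w x > 0}"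
  define \<phi> where "\<phi> = (\<lambda>x. ln (w x))"
  have D: "D \<noteq> {}" "D \<subseteq> cball 0 1" "bdd_above (\<phi> ` D)"
  proof -
    show "D \<noteq> {}" using a by (auto simp: D_def)
    show "D \<subseteq> cball 0 1"
    proof
      fix x assume "x \<in> D"
      then show "x \<in> cball 0 1" using w(4) [of x] by (cases "norm x \<ge> 1") (auto simp: D_def)
    qed
    have "\<phi> x \<le> ln B" if "x \<in> D" for x
      using that w(3) [of x] by (simp add: D_def \<phi>_def)
    then show "bdd_above (\<phi> ` D)" by (rule bdd_aboveI2)
  qed
  obtain u where u: "norm u < e" "\<And>r. r > 0 \<Longrightarrow> u \<in> max_localized \<phi> D r"
    using exists_small_max_localized [OF uc D e] by blast
  define W where "W = (\<lambda>x. w x * exp (blinfun_apply u x))"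
  have W: "W x = exp (\<phi> x + blinfun_apply u x)" if "x \<in> D" for x
    using that by (simp add: W_def \<phi>_def D_def exp_add)
  have "\<exists>x. x \<in> near_max \<phi> D u (inverse (real (Suc n)))" for n
    using near_max_nonempty [OF D, of "inverse (real (Suc n))" u] by auto
  then obtain X where X: "\<And>n. X n \<in> near_max \<phi> D u (inverse (real (Suc n)))" by metis
  have "Cauchy X"
  proof (rule metric_CauchyI)
    fix r :: real assume "r > 0"
    then obtain \<tau> where \<tau>: "\<tau> > 0" "\<forall>x\<in>near_max \<phi> D u \<tau>. \<forall>y\<in>near_max \<phi> D u \<tau>. dist x y < r"
      using u(2) [OF \<open>r > 0\<close>] by (auto simp: max_localized_def)
    obtain N where N: "inverse (real (Suc N)) < \<tau>" using reals_Archimedean [OF \<tau>(1)] by blast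
    have "X n \<in> near_max \<phi> D u \<tau>" if "n \<ge> N" for n
    proof -
      have "inverse (real (Suc n)) \<le> inverse (real (Suc N))" using that by (simp add: field_simps)
      with N have "inverse (real (Suc n)) \<le> \<tau>" by linarith
      then have "near_max \<phi> D u (inverse (real (Suc n))) \<subseteq> near_max \<phi> D u \<tau>"
        by (intro near_max_perturb [OF D(2), of _ _ 0]) simp_all
      with X [of n] show ?thesis by blast
    qed
    with \<tau>(2) show "\<exists>M. \<forall>m\<ge>M. \<forall>n\<ge>M. dist (X m) (X n) < r" by blast
  qed
  then obtain x0 where x0: "X \<longlonglongrightarrow> x0" by (auto simp: Cauchy_convergent_iff convergent_def)
  have contW: "continuous_on UNIV W"
    unfolding W_def by (intro continuous_intros w(1))
  \<comment> \<open>An additive tolerance 1/(n+1) for the logarithm is a factor exp(1/(n+1)) for W,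
    and this factor tends to 1.\<close>
  have lim: "(\<lambda>n. exp (inverse (real (Suc n))) * W (X n)) \<longlonglongrightarrow> exp 0 * W x0"
    using continuous_on_tendsto_compose [OF contW x0]
    by (intro tendsto_intros LIMSEQ_inverse_real_of_nat) auto
  have max: "W z \<le> W x0" for z
  proof (cases "z \<in> D")
    case True
    have "W z \<le> exp (inverse (real (Suc n))) * W (X n)" for n
      using X [of n] True W [of z] W [of "X n"] by (auto simp: near_max_def add_ac simp flip: exp_add)
    then show ?thesis using LIMSEQ_le_const [OF lim, of "W z"] by simp
  next
    case False
    then have "w z = 0" using w(2) [of z] by (simp add: D_def)
    then show ?thesis using w(2) [of x0] by (simp add: W_def)
  qed
  \<comment> \<open>The maximum is positive because w is positive at a; this excludes points of norm
    at least 1, where w vanishes.\<close>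
  have "W x0 > 0" using max [of a] a by (smt (verit) W_def exp_gt_zero mult_pos_pos)
  then have "norm x0 < 1" using w(4) [of x0] by (cases "norm x0 < 1") (auto simp: W_def)
  with u(1) max that show thesis by (simp add: W_def)
qed

section \<open>Complex-linear functionals and exponential tilts\<close>

lemma bounded_bilinear_scaleC:
  "bounded_bilinear (scaleC :: complex \<Rightarrow> 'a::complex_normed_vector \<Rightarrow> 'a)"
proof
  show "(r *\<^sub>R c) *\<^sub>C x = r *\<^sub>R (c *\<^sub>C x)" for r c and x :: 'a
    by (simp add: scaleR_scaleC [of r x] scaleR_scaleC [of r "c *\<^sub>C x"] scaleC_scaleC scaleR_conv_of_real)
  show "c *\<^sub>C (r *\<^sub>R x) = r *\<^sub>R (c *\<^sub>C x)" for r c and x :: 'a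
    by (simp add: scaleR_scaleC scaleC_scaleC mult.commute)
  show "\<exists>K. \<forall>c (x :: 'a). norm (c *\<^sub>C x) \<le> norm c * norm x * K"
    by (intro exI [of _ 1]) (simp add: norm_scaleC)
qed (simp_all add: scaleC_add_left scaleC_add_right)

text \<open>This is u(x) - i u(i x), the standard complex-linear functional with real part
  u.\<close>

definition complexify :: "('a::complex_normed_vector \<Rightarrow>\<^sub>L real) \<Rightarrow> 'a \<Rightarrow> complex" where
  "complexify u x = Complex (blinfun_apply u x) (- blinfun_apply u (\<i> *\<^sub>C x))"

lemma Re_complexify [simp]: "Re (complexify u x) = blinfun_apply u x"
  by (simp add: complexify_def)

lemma norm_complexify_le: "norm (complexify u x) \<le> norm x * (2 * norm u)"
  using cmod_le [of "complexify u x"] norm_blinfun [of u x] norm_blinfun [of u "\<i> *\<^sub>C x"]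
  by (simp add: complexify_def norm_scaleC algebra_simps)

lemma bounded_linear_complexify: "bounded_linear (complexify u)"
proof (rule bounded_linear_intro)
  show "complexify u (x + y) = complexify u x + complexify u y" for x y
    by (simp add: complexify_def complex_eq_iff scaleC_add_right blinfun.add_right)
  show "complexify u (r *\<^sub>R x) = r *\<^sub>R complexify u x" for r x
    by (simp add: complexify_def complex_eq_iff blinfun.scaleR_right
        bounded_bilinear.scaleR_right [OF bounded_bilinear_scaleC])
qed (rule norm_complexify_le)

lemma complexify_scaleC: "complexify u (c *\<^sub>C x) = c * complexify u x"
proof -
  \<comment> \<open>Only real linearity of u is available, so c x and i c x are expanded in x and i
    x with real coefficients.\<close>
  have c: "c *\<^sub>C x = Re c *\<^sub>R x + Im c *\<^sub>R (\<i> *\<^sub>C x)"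
    by (simp add: scaleR_scaleC scaleC_scaleC mult.commute [of _ \<i>] flip: scaleC_add_left complex_eq)
  have ic: "\<i> *\<^sub>C c *\<^sub>C x = Re c *\<^sub>R (\<i> *\<^sub>C x) - Im c *\<^sub>R x"
  proof -
    have "\<i> * c = of_real (Re c) * \<i> + of_real (- Im c)"
      by (simp add: complex_eq_iff)
    then have "\<i> *\<^sub>C c *\<^sub>C x = Re c *\<^sub>R (\<i> *\<^sub>C x) + (- Im c) *\<^sub>R x"
      by (simp only: scaleR_scaleC scaleC_scaleC scaleC_add_left)
    then show ?thesis by simp
  qed
  have "Re (complexify u (c *\<^sub>C x)) = Re (c * complexify u x)"
    unfolding Re_complexify c by (simp add: complexify_def blinfun.add_right blinfun.scaleR_right)
  moreover have "Im (complexify u (c *\<^sub>C x)) = Im (c * complexify u x)"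
    by (simp add: complexify_def ic blinfun.diff_right blinfun.scaleR_right)
  ultimately show ?thesis by (rule complex_eqI)
qed

text \<open>The modulus of the factor is exp of the real part, so the norm of f is multiplied by
  exp(u x). The restriction gives the value \<open>undefined\<close> off the ball that
  \<open>A_u\<close> prescribes.\<close>

definition exp_tilt :: "('a::complex_normed_vector \<Rightarrow>\<^sub>L real) \<Rightarrow> ('a \<Rightarrow> 'b::complex_normed_vector) \<Rightarrow> 'a \<Rightarrow> 'b" where
  "exp_tilt u f = (\<lambda>x\<in>ball 0 1. exp (complexify u x) *\<^sub>C f x)"

lemma norm_exp_tilt:
  "x \<in> ball 0 1 \<Longrightarrow> norm (exp_tilt u f x) = exp (blinfun_apply u x) * norm (f x)"
  by (simp add: exp_tilt_def norm_scaleC)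

lemma cholomorphic_on_exp_tilt:
  assumes "cholomorphic_on f (ball 0 1)"
  shows "cholomorphic_on (exp_tilt u f) (ball 0 1)"
  unfolding cholomorphic_on_def
proof
  fix x :: 'a assume x: "x \<in> ball 0 1"
  then obtain D where D: "(f has_derivative D) (at x)" "\<And>c h. D (c *\<^sub>C h) = c *\<^sub>C D h"
    using assms unfolding cholomorphic_on_def by blast
  have "(exp has_derivative (\<lambda>h. exp (complexify u x) * h)) (at (complexify u x))"
    using DERIV_exp [of "complexify u x"] by (simp add: has_field_derivative_def)
  then have E: "((\<lambda>x. exp (complexify u x)) has_derivative (\<lambda>h. exp (complexify u x) * complexify u h)) (at x)"
    by (rule has_derivative_compose [OF bounded_linear_imp_has_derivative [OF bounded_linear_complexify]])
  let ?D = "\<lambda>h. exp (complexify u x) *\<^sub>C D h + (exp (complexify u x) * complexify u h) *\<^sub>C f x"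
  have "((\<lambda>x. exp (complexify u x) *\<^sub>C f x) has_derivative ?D) (at x)"
    by (rule bounded_bilinear.FDERIV [OF bounded_bilinear_scaleC E D(1)])
  then have "(exp_tilt u f has_derivative ?D) (at x)"
    by (rule has_derivative_transform_within_open [OF _ open_ball x]) (simp add: exp_tilt_def)
  moreover have "?D (c *\<^sub>C h) = c *\<^sub>C ?D h" for c h
    by (simp add: D(2) complexify_scaleC scaleC_add_right scaleC_scaleC algebra_simps)
  ultimately show "\<exists>D. (exp_tilt u f has_derivative D) (at x) \<and> (\<forall>c h. D (c *\<^sub>C h) = c *\<^sub>C D h)"
    by blast
qed

lemma uniformly_continuous_on_scaleC:
  fixes f :: "'a::metric_space \<Rightarrow> 'b::complex_normed_vector"
  assumes "uniformly_continuous_on S E" "uniformly_continuous_on S f"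
    and "bounded (E ` S)" "bounded (f ` S)"
  shows "uniformly_continuous_on S (\<lambda>x. E x *\<^sub>C f x)"
  unfolding uniformly_continuous_on_def
proof (intro allI impI)
  fix e :: real assume e: "e > 0"
  obtain K M where K: "K > 0" "\<And>x. x \<in> S \<Longrightarrow> norm (E x) \<le> K"
    and M: "M > 0" "\<And>x. x \<in> S \<Longrightarrow> norm (f x) \<le> M"
    using assms(3,4) by (auto simp: bounded_pos)
  obtain d1 where d1: "d1 > 0"
    "\<And>x y. x \<in> S \<Longrightarrow> y \<in> S \<Longrightarrow> dist y x < d1 \<Longrightarrow> dist (E y) (E x) < e / (2 * M)"
    using assms(1) e M(1) unfolding uniformly_continuous_on_def
    by (metis divide_pos_pos mult_pos_pos zero_less_numeral)
  obtain d2 where d2: "d2 > 0"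
    "\<And>x y. x \<in> S \<Longrightarrow> y \<in> S \<Longrightarrow> dist y x < d2 \<Longrightarrow> dist (f y) (f x) < e / (2 * K)"
    using assms(2) e K(1) unfolding uniformly_continuous_on_def
    by (metis divide_pos_pos mult_pos_pos zero_less_numeral)
  have "dist (E y *\<^sub>C f y) (E x *\<^sub>C f x) < e"
    if "x \<in> S" "y \<in> S" "dist y x < min d1 d2" for x y
  proof -
    have "E y *\<^sub>C f y - E x *\<^sub>C f x = (E y - E x) *\<^sub>C f y + E x *\<^sub>C (f y - f x)"
      by (simp add: bounded_bilinear.diff_left [OF bounded_bilinear_scaleC]
          bounded_bilinear.diff_right [OF bounded_bilinear_scaleC])
    then have "dist (E y *\<^sub>C f y) (E x *\<^sub>C f x) \<le> norm (E y - E x) * norm (f y) + norm (E x) * norm (f y - f x)"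
      unfolding dist_norm by (metis norm_scaleC norm_triangle_ineq)
    also have "\<dots> \<le> norm (E y - E x) * M + K * norm (f y - f x)"
      using that K M by (intro add_mono mult_mono) auto
    also have "\<dots> < e / (2 * M) * M + K * (e / (2 * K))"
      using that d1(2) [of x y] d2(2) [of x y] K(1) M(1)
      by (intro add_strict_mono mult_strict_right_mono mult_strict_left_mono) (auto simp: dist_norm)
    also have "\<dots> = e" using K(1) M(1) by simp
    finally show ?thesis .
  qed
  with d1(1) d2(1)
  show "\<exists>d>0. \<forall>x\<in>S. \<forall>x'\<in>S. dist x' x < d \<longrightarrow> dist (E x' *\<^sub>C f x') (E x *\<^sub>C f x) < e"
    by (intro exI [of _ "min d1 d2"]) auto
qed

text \<open>The complex exponential is not uniformly continuous on the plane, but the functional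
  maps the unit ball into a compact disc, where exp is uniformly continuous and bounded.\<close>

lemma exp_tilt_in_A_u:
  fixes f :: "'a::complex_banach \<Rightarrow> 'b::complex_banach"
  assumes f: "f \<in> A_u"
  shows "exp_tilt u f \<in> A_u"
proof -
  let ?B = "ball (0::'a) 1" and ?K = "cball (0::complex) (2 * norm u)"
  have p: "complexify u ` ?B \<subseteq> ?K"
  proof clarify
    fix x :: 'a assume "x \<in> ?B"
    then show "complexify u x \<in> ?K"
      using norm_complexify_le [of u x] mult_right_mono [of "norm x" 1 "2 * norm u"] by simp
  qed
  have "uniformly_continuous_on ?K (exp :: complex \<Rightarrow> complex)"
    by (intro compact_uniformly_continuous compact_cball continuous_intros)
  then have "uniformly_continuous_on (complexify u ` ?B) (exp :: complex \<Rightarrow> complex)"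
    using p unfolding uniformly_continuous_on_def by (meson subsetD)
  then have E: "uniformly_continuous_on ?B (\<lambda>x. exp (complexify u x))"
    by (rule uniformly_continuous_on_compose [OF bounded_linear.uniformly_continuous_on
          [OF bounded_linear_complexify uniformly_continuous_on_id]])
  have "compact ((exp :: complex \<Rightarrow> complex) ` ?K)"
    by (intro compact_continuous_image compact_cball continuous_intros)
  then have bE: "bounded ((\<lambda>x. exp (complexify u x)) ` ?B)"
    using p by (intro bounded_subset [OF compact_imp_bounded]) auto
  have "uniformly_continuous_on ?B (\<lambda>x. exp (complexify u x) *\<^sub>C f x)"
    using f A_u_bounded [OF f] by (intro uniformly_continuous_on_scaleC E bE) (auto simp: A_u_def)
  then have "uniformly_continuous_on ?B (exp_tilt u f)"
    by (simp add: uniformly_continuous_on_def exp_tilt_def)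
  then show ?thesis
    using f cholomorphic_on_exp_tilt [of f u] by (auto simp: A_u_def exp_tilt_def)
qed

lemma sup_dist_exp_tilt_less:
  fixes f :: "'a::complex_banach \<Rightarrow> 'b::complex_banach"
  assumes f: "f \<in> A_u" and e: "e > 0"
  obtains d where "d > 0" "\<And>u. norm u < d \<Longrightarrow> sup_dist f (exp_tilt u f) < e"
proof -
  obtain M where M: "M > 0" "\<And>x. x \<in> ball 0 1 \<Longrightarrow> norm (f x) \<le> M"
    using A_u_bounded [OF f] by (auto simp: bounded_pos)
  have "isCont (exp :: complex \<Rightarrow> complex) 0" by (intro continuous_intros)
  moreover have "e / (2 * M) > 0" using e M(1) by simp
  ultimately obtain d where d: "d > 0"
    "\<And>z::complex. dist z 0 < d \<Longrightarrow> dist (exp z) (exp 0) < e / (2 * M)"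
    unfolding continuous_at_eps_delta by metis
  show thesis
  proof
    \<comment> \<open>The radius is halved because \<open>norm_complexify_le\<close> bounds the
      complex functional on the ball by 2 * norm u.\<close>
    show "d / 2 > 0" using d by simp
    fix u :: "'a \<Rightarrow>\<^sub>L real" assume u: "norm u < d / 2"
    have "norm (f x - exp_tilt u f x) \<le> e / 2" if x: "x \<in> ball 0 1" for x
    proof -
      have "norm (complexify u x) \<le> 1 * (2 * norm u)"
        using norm_complexify_le [of u x] mult_right_mono [of "norm x" 1 "2 * norm u"] x by simp
      then have "dist (complexify u x) 0 < d" using u by simp
      then have *: "norm (1 - exp (complexify u x)) < e / (2 * M)"
        using d(2) by (force simp: dist_norm norm_minus_commute)
      have "f x - exp_tilt u f x = (1 - exp (complexify u x)) *\<^sub>C f x"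
        using x by (simp add: exp_tilt_def scaleC_one bounded_bilinear.diff_left [OF bounded_bilinear_scaleC])
      then have "norm (f x - exp_tilt u f x) = norm (1 - exp (complexify u x)) * norm (f x)"
        by (simp add: norm_scaleC)
      also have "\<dots> \<le> e / (2 * M) * M" using * M(2) [OF x] M(1) e by (intro mult_mono) auto
      finally show ?thesis using M(1) by simp
    qed
    then have "sup_norm (\<lambda>x. f x - exp_tilt u f x) \<le> e / 2"
      unfolding sup_norm_def by (intro cSUP_least) auto
    then show "sup_dist f (exp_tilt u f) < e"
      using e f exp_tilt_in_A_u [OF f, of u] by (simp add: sup_dist_def)
  qed
qed

section \<open>Attainment of the v-norm and density\<close>

lemma attains_v_normI:
  assumes x0: "x0 \<in> ball 0 1"
    and max: "\<And>x. x \<in> ball 0 1 \<Longrightarrow> (1 - (norm x)\<^sup>2) * norm (f x) \<le> (1 - (norm x0)\<^sup>2) * norm (f x0)"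
  shows "attains_v_norm f"
proof -
  have "v_norm f = (1 - (norm x0)\<^sup>2) * norm (f x0)"
    unfolding v_norm_def using assms by (intro cSup_eq_maximum) auto
  with x0 show ?thesis
    unfolding attains_v_norm_def by (intro bexI [of _ x0]) (auto simp: cball_ext_def)
qed

text \<open>On the unit sphere continuity comes from the weight tending to 0 while f stays bounded;
  no boundary values of f enter.\<close>

lemma continuous_weighted_norm:
  assumes cont: "continuous_on (ball 0 1) f"
    and M: "\<And>x. x \<in> ball 0 1 \<Longrightarrow> norm (f x) \<le> M"
  shows "continuous_on UNIV (\<lambda>x. if norm x < 1 then (1 - (norm x)\<^sup>2) * norm (f x) else 0)"
    (is "continuous_on UNIV ?w")
proof -
  have bound: "norm (?w x) \<le> \<bar>1 - (norm x)\<^sup>2\<bar> * \<bar>M\<bar>" for x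
    using M [of x] by (auto simp: abs_mult intro!: mult_left_mono)
  have "isCont ?w a" for a
  proof (cases "norm a < 1")
    case True
    then have a: "a \<in> ball 0 1" by simp
    have "continuous_on (ball 0 1) (\<lambda>x. (1 - (norm x)\<^sup>2) * norm (f x))"
      by (intro continuous_intros cont)
    then have "continuous_on (ball 0 1) ?w" by (rule continuous_on_eq) auto
    then show ?thesis using a by (simp add: continuous_on_eq_continuous_at)
  next
    case False
    show ?thesis
    proof (cases "norm a = 1")
      case True
      have "((\<lambda>x. \<bar>1 - (norm x)\<^sup>2\<bar> * \<bar>M\<bar>) \<longlongrightarrow> \<bar>1 - (norm a)\<^sup>2\<bar> * \<bar>M\<bar>) (at a)"
        by (intro tendsto_intros)
      then have "((\<lambda>x. \<bar>1 - (norm x)\<^sup>2\<bar> * \<bar>M\<bar>) \<longlongrightarrow> 0) (at a)" using True by simp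
      then have "(?w \<longlongrightarrow> 0) (at a)"
        by (rule Lim_null_comparison [OF always_eventually [OF allI [OF bound]]])
      then show ?thesis using True by (simp add: isCont_def)
    next
      case False
      with \<open>\<not> norm a < 1\<close> have a: "a \<in> - cball 0 1" by auto
      have "continuous_on (- cball 0 1) ?w"
        by (rule continuous_on_eq [OF continuous_on_const [of _ 0]]) auto
      then show ?thesis using a by (simp add: continuous_on_eq_continuous_at open_Compl)
    qed
  qed
  then show ?thesis by (simp add: continuous_at_imp_continuous_on)
qed

text \<open>The weighted norm of f, extended by zero, meets the hypotheses of the variational
  principle; its tilt by exp(u) is the weighted norm of \<open>exp_tilt u f\<close> on the
  ball.\<close>

lemma exists_exp_tilt_in_NA_v:
  fixes f :: "'a::complex_banach \<Rightarrow> 'b::complex_banach"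
  assumes uc: "uniformly_convex TYPE('a)" and f: "f \<in> A_u" and d: "d > 0"
  obtains u where "norm u < d" "exp_tilt u f \<in> NA_v"
proof -
  define w where "w = (\<lambda>x. if norm x < 1 then (1 - (norm x)\<^sup>2) * norm (f x) else 0)"
  obtain M where M: "M > 0" "\<And>x. x \<in> ball 0 1 \<Longrightarrow> norm (f x) \<le> M"
    using A_u_bounded [OF f] by (auto simp: bounded_pos)
  have "continuous_on (ball 0 1) f"
    using f by (simp add: A_u_def uniformly_continuous_imp_continuous)
  then have cont: "continuous_on UNIV w"
    unfolding w_def using M(2) by (rule continuous_weighted_norm)
  have nonneg: "0 \<le> w x" for x by (simp add: w_def power_le_one)
  have bounded: "w x \<le> M" for x
  proof (cases "norm x < 1")
    case True
    then have "(1 - (norm x)\<^sup>2) * norm (f x) \<le> 1 * M"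
      using M by (intro mult_mono) auto
    with True show ?thesis by (simp add: w_def)
  qed (use M in \<open>simp add: w_def\<close>)
  have outside: "w x = 0" if "norm x \<ge> 1" for x using that by (simp add: w_def)
  obtain u x0 where u: "norm u < d" "norm x0 < 1"
    "\<And>x. w x * exp (blinfun_apply u x) \<le> w x0 * exp (blinfun_apply u x0)"
    using exists_tilt_attaining_max [OF uc cont nonneg bounded outside d] by blast
  have eq: "(1 - (norm x)\<^sup>2) * norm (exp_tilt u f x) = w x * exp (blinfun_apply u x)"
    if "x \<in> ball 0 1" for x
    using that norm_exp_tilt [OF that, of u f] by (simp add: w_def)
  have "attains_v_norm (exp_tilt u f)"
    using u(2,3) eq by (intro attains_v_normI [of x0]) auto
  with u(1) that exp_tilt_in_A_u [OF f] show thesis by (auto simp: NA_v_def)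
qed

theorem corollary3p5:
  assumes "uniformly_convex TYPE('a::complex_banach)"
  shows "Metric_space.mtopology A_u sup_dist closure_of NA_v
           = (A_u :: ('a \<Rightarrow> 'b::complex_banach) set)"
proof -
  interpret A: Metric_space "A_u :: ('a \<Rightarrow> 'b) set" sup_dist by (rule Metric_space_A_u)
  \<comment> \<open>Only density has to be shown: a closure in this metric space consists of members
    of \<open>A_u\<close> by definition.\<close>
  have "\<exists>g\<in>NA_v. g \<in> A.mball f e" if f: "f \<in> A_u" and e: "e > 0" for f :: "'a \<Rightarrow> 'b" and e
  proof -
    obtain d where d: "d > 0" "\<And>u. norm u < d \<Longrightarrow> sup_dist f (exp_tilt u f) < e"
      using sup_dist_exp_tilt_less [OF f e] by blast
    obtain u where "norm u < d" "exp_tilt u f \<in> NA_v"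
      using exists_exp_tilt_in_NA_v [OF assms f d(1)] by blast
    with d(2) f exp_tilt_in_A_u [OF f] show ?thesis by (intro bexI [of _ "exp_tilt u f"]) auto
  qed
  then show ?thesis unfolding A.metric_closure_of by blast
qed

end
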